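(* For every natural number $k\ge 1$ there exists a parity signed graph $S$ whose underlying graph $G$ satisfies $\sigma^-(G)=k$.
   Context: For a graph $G$ with $N$ vertices and a bijection $f:V(G)\to\{1,\dots,N\}$, define $\sigma_f(uv)=+$ if $f(u),f(v)$ have the same parity and $\sigma_f(uv)=-$ otherwise; a signed graph $(G,\sigma)$ is a parity signed graph if $\sigma=\sigma_f$ for some such $f$. The rna number $\sigma^-(G)$ (also written $\sigma^-(S)$ for a signed graph $S$ on $G$) is the minimum over all such bijections $f$ of the number of edges $uv$ with $\sigma_f(uv)=-$. *)

theory Defs
  imports Main
begin

record 'a ugraph =
  verts :: "'a set"
  edges :: "'a set set"

definition simple_graph :: "'a ugraph \<Rightarrow> bool" where
  "simple_graph G \<longleftrightarrow>
     finite (verts G) \<and> (\<forall>e \<in> edges G. e \<subseteq> verts G \<and> card e = 2)"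

datatype sign = Pos | Neg

(* Only the values of sgn_of on the edges of the underlying graph are meaningful. *)
record 'a signed_graph =
  underlying :: "'a ugraph"
  sgn_of :: "'a set \<Rightarrow> sign"

definition parity_labelling :: "'a ugraph \<Rightarrow> ('a \<Rightarrow> nat) \<Rightarrow> bool" where
  "parity_labelling G f \<longleftrightarrow> bij_betw f (verts G) {1..card (verts G)}"

definition parity_sign :: "('a \<Rightarrow> nat) \<Rightarrow> 'a set \<Rightarrow> sign" where
  "parity_sign f e = (if \<forall>u\<in>e. \<forall>v\<in>e. even (f u) \<longleftrightarrow> even (f v) then Pos else Neg)"

lemma parity_sign_edge:
  "parity_sign f {u, v} = (if even (f u) \<longleftrightarrow> even (f v) then Pos else Neg)"
  by (auto simp: parity_sign_def)

definition parity_signed_graph :: "'a signed_graph \<Rightarrow> bool" where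
  "parity_signed_graph S \<longleftrightarrow>
     simple_graph (underlying S) \<and>
     (\<exists>f. parity_labelling (underlying S) f \<and>
          (\<forall>e \<in> edges (underlying S). sgn_of S e = parity_sign f e))"

definition negative_edges :: "'a ugraph \<Rightarrow> ('a \<Rightarrow> nat) \<Rightarrow> 'a set set" where
  "negative_edges G f = {e \<in> edges G. parity_sign f e = Neg}"

definition rna_number :: "'a ugraph \<Rightarrow> nat" where
  "rna_number G = Min {card (negative_edges G f) | f. parity_labelling G f}"

(* For a simple graph the minimum ranges over a finite nonempty set. *)
lemma rna_number_set:
  assumes "simple_graph G"
  shows "finite {card (negative_edges G f) | f. parity_labelling G f}"
    and "{card (negative_edges G f) | f. parity_labelling G f} \<noteq> {}"
proof -
  have "edges G \<subseteq> Pow (verts G)" and fin: "finite (verts G)"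
    using assms by (auto simp: simple_graph_def)
  then have "finite (edges G)"
    by (meson finite_Pow_iff finite_subset)
  then have "{card (negative_edges G f) | f. parity_labelling G f} \<subseteq> {..card (edges G)}"
    by (auto simp: negative_edges_def intro: card_mono)
  then show "finite {card (negative_edges G f) | f. parity_labelling G f}"
    by (rule finite_subset) simp
  obtain f where "bij_betw f (verts G) {1..card (verts G)}"
    using finite_same_card_bij[OF fin, of "{1..card (verts G)}"] by auto
  then show "{card (negative_edges G f) | f. parity_labelling G f} \<noteq> {}"
    by (auto simp: parity_labelling_def)
qed

end

theory Submission
  imports Defs
begin

text \<open>In a star on \<open>2 * k\<close> vertices the negative edges of a labelling correspond to the
  labels whose parity differs from that of the centre. Exactly half of the labels
  \<open>1, \<dots>, 2 * k\<close> have either parity, so every labelling has exactly \<open>k\<close> negative edges.\<close>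

definition star_graph :: "nat \<Rightarrow> nat ugraph" where
  "star_graph n = \<lparr>verts = {0..<n}, edges = (\<lambda>v. {0, v}) ` {1..<n}\<rparr>"

lemma simple_graph_star: "simple_graph (star_graph n)"
  by (auto simp: simple_graph_def star_graph_def)

lemma card_parity_class:
  "card {m \<in> {1..2 * k}. even m \<noteq> b} = k" for k :: nat
proof (induction k)
  case (Suc k)
  have "{m \<in> {1..2 * Suc k}. even m \<noteq> b} =
      insert (if b then 2 * k + 1 else 2 * k + 2) {m \<in> {1..2 * k}. even m \<noteq> b}"
    by (cases b) (auto simp: le_Suc_eq)
  then show ?case
    using Suc by simp
qed simp

lemma card_negative_edges_star:
  assumes "parity_labelling (star_graph (2 * k)) f"
  shows "card (negative_edges (star_graph (2 * k)) f) = k"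
proof -
  let ?V = "{v \<in> {0..<2 * k}. even (f v) \<noteq> even (f 0)}"
  have bij: "bij_betw f {0..<2 * k} {1..2 * k}"
    using assms by (simp add: parity_labelling_def star_graph_def)
  have "v \<ge> 1" if "v \<in> ?V" for v
    using that by (cases v) auto
  then have "negative_edges (star_graph (2 * k)) f = (\<lambda>v. {0, v}) ` ?V"
    by (fastforce simp: negative_edges_def star_graph_def parity_sign_edge split: if_splits)
  moreover have "inj_on (\<lambda>v. {0, v}) ?V"
    by (auto simp: inj_on_def doubleton_eq_iff)
  ultimately have "card (negative_edges (star_graph (2 * k)) f) = card ?V"
    by (simp add: card_image)
  also have "card ?V = card (f ` ?V)"
  proof (rule card_image[symmetric])
    show "inj_on f ?V"
      using bij_betw_imp_inj_on[OF bij] by (rule inj_on_subset) blast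
  qed
  also have "f ` ?V = {m \<in> f ` {0..<2 * k}. even m \<noteq> even (f 0)}"
    by blast
  also have "card \<dots> = k"
    unfolding bij_betw_imp_surj_on[OF bij] by (rule card_parity_class)
  finally show ?thesis .
qed

lemma rna_number_star: "rna_number (star_graph (2 * k)) = k"
proof -
  let ?A = "{card (negative_edges (star_graph (2 * k)) f) | f.
    parity_labelling (star_graph (2 * k)) f}"
  have "?A \<noteq> {}"
    by (rule rna_number_set(2)[OF simple_graph_star])
  moreover have "?A \<subseteq> {k}"
    using card_negative_edges_star by auto
  ultimately have "?A = {k}"
    by (simp only: subset_singleton_iff simp_thms)
  then show ?thesis
    by (simp only: rna_number_def Min_singleton)
qed

theorem theorem13:
  fixes k :: nat
  assumes "k \<ge> 1"
  shows "\<exists>S :: nat signed_graph. parity_signed_graph S \<and> rna_number (underlying S) = k"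
proof -
  let ?G = "star_graph (2 * k)"
  obtain f where "parity_labelling ?G f"
    using rna_number_set(2)[OF simple_graph_star] by blast
  then have "parity_signed_graph \<lparr>underlying = ?G, sgn_of = parity_sign f\<rparr>"
    using simple_graph_star by (auto simp: parity_signed_graph_def)
  then show ?thesis
    using rna_number_star by (metis signed_graph.select_convs(1))
qed

end
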